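(* For all integers $n\ge 0$, $$H_{n,\lambda}^{Y}(x)= \sum_{k=0}^{n}\binom{x}{k}k!\,B_{n,k}\Big(H_{1,\lambda}^{Y},H_{2,\lambda}^{Y},\dots,H_{n-k+1,\lambda}^{Y}\Big).$$
   Context: Let $Y$ be a real random variable with $E[|Y|^{n}]<\infty$ for all integers $n\ge 0$ and $\lim_{n\to\infty}|t|^{n}E[|Y|^{n}]/n!=0$ for $|t|<r$, for some $r>0$. Fix a nonzero real $\lambda$. Put $\langle x\rangle_{0,\lambda}=1$, $\langle x\rangle_{n,\lambda}=x(x+\lambda)\cdots(x+(n-1)\lambda)$, and $e_\lambda^{-Y}(-t)=(1-\lambda t)^{-Y/\lambda}$, so $E[e_\lambda^{-Y}(-t)]=\sum_{n\ge0}E[\langle Y\rangle_{n,\lambda}]t^n/n!$ near $t=0$. The probabilistic heterogeneous Bell polynomials are defined by $e^{x(E[e_{\lambda}^{-Y}(-t)]-1)}=\sum_{n\ge0}H_{n,\lambda}^{Y}(x)t^{n}/n!$, and $H^Y_{n,\lambda}=H^Y_{n,\lambda}(1)$ (probabilistic heterogeneous Bell numbers). $\binom{x}{k}=x(x-1)\cdots(x-k+1)/k!$. The partial Bell polynomials $B_{n,k}$ are defined by $\frac{1}{k!}\big(\sum_{m\ge1}x_{m}\frac{t^{m}}{m!}\big)^{k}=\sum_{n\ge k}B_{n,k}(x_{1},\dots,x_{n-k+1})\frac{t^{n}}{n!}$. *)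

theory Defs
  imports "HOL-Probability.Probability" "HOL-Complex_Analysis.Complex_Analysis"
begin

definition degenerate_exp :: "real \<Rightarrow> real \<Rightarrow> real \<Rightarrow> real"
  where "degenerate_exp lam a t = (1 + lam * t) powr (a / lam)"

definition degenerate_rising :: "real \<Rightarrow> nat \<Rightarrow> real \<Rightarrow> real"
  where "degenerate_rising lam n y = (\<Prod>i<n. y + real i * lam)"

definition prob_het_bell_gf :: "'a measure \<Rightarrow> ('a \<Rightarrow> real) \<Rightarrow> real \<Rightarrow> real \<Rightarrow> real \<Rightarrow> real"
  where "prob_het_bell_gf M Y lam x t =
    exp (x * ((\<integral>\<omega>. degenerate_exp lam (- Y \<omega>) (- t) \<partial>M) - 1))"

text \<open>The description is well-defined under the moment assumptions on \<open>Y\<close>: see lemma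
  \<open>prob_het_bell_sums\<close> below for existence and \<open>egf_unique\<close> for uniqueness.\<close>

definition prob_het_bell :: "'a measure \<Rightarrow> ('a \<Rightarrow> real) \<Rightarrow> real \<Rightarrow> nat \<Rightarrow> real \<Rightarrow> real"
  where "prob_het_bell M Y lam n x =
    (THE h. \<forall>\<^sub>F t in nhds 0. (\<lambda>m. h m * t ^ m / fact m) sums prob_het_bell_gf M Y lam x t) n"

text \<open>The indeterminates \<open>x\<^sub>1, x\<^sub>2, \<dots>\<close> of the partial Bell polynomials are passed as a sequence
  \<open>xs\<close>; only the entries \<open>1, \<dots>, n - k + 1\<close> matter (lemma \<open>partial_bell_cong\<close>).\<close>

definition partial_bell :: "nat \<Rightarrow> nat \<Rightarrow> (nat \<Rightarrow> real) \<Rightarrow> real"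
  where "partial_bell n k xs =
    fact n * fps_nth (fps_const (1 / fact k) * Abs_fps (\<lambda>m. if m = 0 then 0 else xs m / fact m) ^ k) n"

lemma egf_unique:
  fixes a b :: "nat \<Rightarrow> real"
  assumes "\<forall>\<^sub>F t in nhds 0. (\<lambda>m. a m * t ^ m / fact m) sums f t"
    and "\<forall>\<^sub>F t in nhds 0. (\<lambda>m. b m * t ^ m / fact m) sums f t"
  shows "a = b"
proof (rule ccontr)
  assume "a \<noteq> b"
  define c where "c = (\<lambda>m. (a m - b m) / fact m)"
  have "\<forall>\<^sub>F t in nhds 0. (\<lambda>m. c m * t ^ m) sums 0"
    using assms
  proof eventually_elim
    case (elim t)
    from sums_diff[OF elim] show ?case
      by (simp add: c_def diff_divide_distrib left_diff_distrib)
  qed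
  then obtain e where e: "e > 0" "\<And>t. \<bar>t\<bar> < e \<Longrightarrow> (\<lambda>m. c m * t ^ m) sums 0"
    by (auto simp: eventually_nhds_metric dist_real_def)
  from e(2)[of 0] e(1) have "c 0 = 0"
    using powser_sums_zero_iff[of c 0] by simp
  from \<open>a \<noteq> b\<close> obtain m where "c m \<noteq> 0"
    by (auto simp: c_def fun_eq_iff)
  with \<open>c 0 = 0\<close> have "m > 0"
    by (cases m) auto
  obtain s where "0 < s" "\<And>z::real. z \<in> cball 0 s - {0} \<Longrightarrow> (0::real) \<noteq> 0"
    by (rule powser_0_nonzero[of e 0 c "\<lambda>_. 0" m]) (use e \<open>c m \<noteq> 0\<close> \<open>m > 0\<close> in auto)
  from this(2)[of s] this(1) show False by simp
qed

lemma exp_moment: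
  fixes Y :: "'a \<Rightarrow> real"
  assumes int: "\<And>m::nat. integrable M (\<lambda>\<omega>. \<bar>Y \<omega>\<bar> ^ m)"
    and lim: "\<And>t::real. \<bar>t\<bar> < r \<Longrightarrow>
           (\<lambda>m. \<bar>t\<bar> ^ m * (\<integral>\<omega>. \<bar>Y \<omega>\<bar> ^ m \<partial>M) / fact m) \<longlonglongrightarrow> 0"
    and s: "0 \<le> s" "s < r"
  shows "integrable M (\<lambda>\<omega>. exp (s * \<bar>Y \<omega>\<bar>))"
proof -
  define s' where "s' = (s + r) / 2"
  have s': "s < s'" "s' < r" "s' > 0"
    using s by (auto simp: s'_def)
  let ?E = "\<lambda>m. \<integral>\<omega>. \<bar>Y \<omega>\<bar> ^ m \<partial>M"
  have "Bseq (\<lambda>m. \<bar>s'\<bar> ^ m * ?E m / fact m)"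
    using lim[of s'] s' by (intro convergent_imp_Bseq convergentI) auto
  then obtain B where B: "\<And>m. \<bar>\<bar>s'\<bar> ^ m * ?E m / fact m\<bar> \<le> B"
    by (auto simp: Bseq_def)
  have E0: "?E m \<ge> 0" for m
    by simp
  have "summable (\<lambda>m. s ^ m * ?E m / fact m)"
  proof (rule summable_comparison_test')
    show "summable (\<lambda>m. B * (s / s') ^ m)"
      using s s' by (intro summable_mult summable_geometric) auto
    fix m :: nat
    have "s ^ m * ?E m / fact m = (s' ^ m * ?E m / fact m) * (s / s') ^ m"
      using s' by (simp add: power_divide)
    also have "\<dots> \<le> B * (s / s') ^ m"
      using B[of m] s s' by (intro mult_right_mono) auto
    finally show "norm (s ^ m * ?E m / fact m) \<le> B * (s / s') ^ m"
      using E0[of m] s by (simp add: abs_mult)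
  qed
  moreover have "(\<integral>\<omega>. norm ((s * \<bar>Y \<omega>\<bar>) ^ m / fact m) \<partial>M) = s ^ m * ?E m / fact m" for m
  proof -
    have "(\<integral>\<omega>. norm ((s * \<bar>Y \<omega>\<bar>) ^ m / fact m) \<partial>M) = (\<integral>\<omega>. (s ^ m / fact m) * \<bar>Y \<omega>\<bar> ^ m \<partial>M)"
      using s by (intro Bochner_Integration.integral_cong) (auto simp: power_mult_distrib abs_mult)
    also have "\<dots> = (s ^ m / fact m) * ?E m"
      by (rule integral_mult_right_zero)
    finally show ?thesis by simp
  qed
  moreover have "integrable M (\<lambda>\<omega>. (s * \<bar>Y \<omega>\<bar>) ^ m / fact m)" for m
    using int[of m] by (simp add: power_mult_distrib)
  moreover have "AE \<omega> in M. summable (\<lambda>m. norm ((s * \<bar>Y \<omega>\<bar>) ^ m / fact m))"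
  proof (rule AE_I2)
    fix \<omega>
    show "summable (\<lambda>m. norm ((s * \<bar>Y \<omega>\<bar>) ^ m / fact m))"
      using summable_norm_exp[of "s * \<bar>Y \<omega>\<bar>"] by (simp add: field_simps)
  qed
  ultimately have "integrable M (\<lambda>\<omega>. \<Sum>m. (s * \<bar>Y \<omega>\<bar>) ^ m / fact m)"
    by (intro integrable_suminf) auto
  thus ?thesis
    by (simp add: exp_def divide_inverse mult.commute)
qed

lemma degenerate_exp_sums:
  assumes "lam \<noteq> 0" "\<bar>lam * t\<bar> < 1"
  shows "(\<lambda>m. degenerate_rising lam m y * t ^ m / fact m) sums degenerate_exp lam (- y) (- t)"
proof -
  have "((- y / lam) gchoose m) * (lam * - t) ^ m = degenerate_rising lam m y * t ^ m / fact m" for m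
  proof -
    have "(\<Prod>i<m. - y / lam - real i) * (lam * - t) ^ m = (\<Prod>i<m. (- y / lam - real i) * (lam * - t))"
      by (simp only: prod.distrib prod_constant card_lessThan power_mult_distrib)
    also have "\<dots> = (\<Prod>i<m. (y + real i * lam) * t)"
      using assms by (intro prod.cong) (auto simp: field_simps)
    also have "\<dots> = degenerate_rising lam m y * t ^ m"
      by (simp add: prod.distrib degenerate_rising_def)
    finally show ?thesis
      by (simp add: gbinomial_prod_rev atLeast0LessThan)
  qed
  with gen_binomial_real[of "lam * - t" "- y / lam"] assms show ?thesis
    by (simp add: degenerate_exp_def)
qed

lemma abs_degenerate_rising_le:
  "\<bar>degenerate_rising lam m y\<bar> \<le> degenerate_rising \<bar>lam\<bar> m \<bar>y\<bar>"
  unfolding degenerate_rising_def abs_prod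
proof (rule prod_mono)
  fix i
  have "\<bar>y + real i * lam\<bar> \<le> \<bar>y\<bar> + \<bar>real i * lam\<bar>"
    by (rule abs_triangle_ineq)
  thus "0 \<le> \<bar>y + real i * lam\<bar> \<and> \<bar>y + real i * lam\<bar> \<le> \<bar>y\<bar> + real i * \<bar>lam\<bar>"
    by (simp add: abs_mult)
qed

lemma expectation_degenerate_exp_sums:
  fixes M :: "'a measure" and Y :: "'a \<Rightarrow> real" and r lam :: real
  assumes Y: "Y \<in> borel_measurable M"
    and int: "\<And>m::nat. integrable M (\<lambda>\<omega>. \<bar>Y \<omega>\<bar> ^ m)"
    and r: "r > 0"
    and lim: "\<And>t::real. \<bar>t\<bar> < r \<Longrightarrow>
           (\<lambda>m. \<bar>t\<bar> ^ m * (\<integral>\<omega>. \<bar>Y \<omega>\<bar> ^ m \<partial>M) / fact m) \<longlonglongrightarrow> 0"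
    and lam: "lam \<noteq> 0"
  shows "\<forall>\<^sub>F t in nhds 0. (\<lambda>m. (\<integral>\<omega>. degenerate_rising lam m (Y \<omega>) \<partial>M) * t ^ m / fact m) sums
           (\<integral>\<omega>. degenerate_exp lam (- Y \<omega>) (- t) \<partial>M)"
proof -
  have "isCont (\<lambda>t. - ln (1 - \<bar>lam\<bar> * \<bar>t\<bar>) / \<bar>lam\<bar>) 0"
    using lam by (intro continuous_intros) auto
  hence "((\<lambda>t. - ln (1 - \<bar>lam\<bar> * \<bar>t\<bar>) / \<bar>lam\<bar>) \<longlongrightarrow> 0) (nhds 0)"
    by (simp add: isCont_def tendsto_nhds_iff)
  hence ev1: "\<forall>\<^sub>F t in nhds 0. - ln (1 - \<bar>lam\<bar> * \<bar>t\<bar>) / \<bar>lam\<bar> < r"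
    using r by (rule order_tendstoD(2))
  have "isCont (\<lambda>t. \<bar>lam * t\<bar>) 0"
    by (intro continuous_intros)
  hence "((\<lambda>t. \<bar>lam * t\<bar>) \<longlongrightarrow> 0) (nhds 0)"
    by (simp add: isCont_def tendsto_nhds_iff)
  hence ev2: "\<forall>\<^sub>F t in nhds 0. \<bar>lam * t\<bar> < 1"
    by (rule order_tendstoD(2)) simp
  from ev1 ev2 show ?thesis
  proof eventually_elim
    case (elim t)
    define s where "s = - ln (1 - \<bar>lam\<bar> * \<bar>t\<bar>) / \<bar>lam\<bar>"
    have lt: "\<bar>lam\<bar> * \<bar>t\<bar> < 1"
      using elim by (simp add: abs_mult)
    have "s \<ge> 0"
      using lt lam unfolding s_def by (intro divide_nonneg_nonneg) auto
    have expint: "integrable M (\<lambda>\<omega>. exp (s * \<bar>Y \<omega>\<bar>))"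
      by (rule exp_moment[OF int lim \<open>s \<ge> 0\<close>]) (use elim in \<open>auto simp: s_def\<close>)
    define f where "f = (\<lambda>m \<omega>. degenerate_rising lam m (Y \<omega>) * t ^ m / fact m)"
    define g where "g = (\<lambda>m \<omega>. degenerate_rising \<bar>lam\<bar> m \<bar>Y \<omega>\<bar> * \<bar>t\<bar> ^ m / fact m)"
    have fg: "norm (f m \<omega>) \<le> g m \<omega>" for m \<omega>
      unfolding f_def g_def using abs_degenerate_rising_le[of lam m "Y \<omega>"]
      by (auto simp: abs_mult power_abs intro!: divide_right_mono mult_right_mono)
    have g0: "g m \<omega> \<ge> 0" for m \<omega>
      using fg[of m \<omega>] norm_ge_zero[of "f m \<omega>"] by linarith
    have gsums: "(\<lambda>m. g m \<omega>) sums exp (s * \<bar>Y \<omega>\<bar>)" for \<omega>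
    proof -
      have "degenerate_exp \<bar>lam\<bar> (- \<bar>Y \<omega>\<bar>) (- \<bar>t\<bar>) = exp (s * \<bar>Y \<omega>\<bar>)"
        using lt by (simp add: degenerate_exp_def powr_def s_def mult.commute)
      thus ?thesis
        using degenerate_exp_sums[of "\<bar>lam\<bar>" "\<bar>t\<bar>" "\<bar>Y \<omega>\<bar>"] lam lt by (simp add: g_def)
    qed
    have [measurable]: "f m \<in> borel_measurable M" for m
      unfolding f_def degenerate_rising_def using Y by measurable
    have bound: "(\<Sum>m<N. norm (f m \<omega>)) \<le> exp (s * \<bar>Y \<omega>\<bar>)" for N \<omega>
    proof -
      have "(\<Sum>m<N. norm (f m \<omega>)) \<le> (\<Sum>m<N. g m \<omega>)"
        by (intro sum_mono fg)
      also have "\<dots> \<le> exp (s * \<bar>Y \<omega>\<bar>)"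
        using gsums[of \<omega>] g0 sum_le_suminf[of "\<lambda>m. g m \<omega>" "{..<N}"] by (auto simp: sums_iff)
      finally show ?thesis .
    qed
    have fint: "integrable M (f m)" for m
    proof (rule Bochner_Integration.integrable_bound[OF expint])
      have "norm (f m \<omega>) \<le> exp (s * \<bar>Y \<omega>\<bar>)" for \<omega>
      proof -
        have "norm (f m \<omega>) \<le> (\<Sum>k<Suc m. norm (f k \<omega>))"
          by (simp add: sum_nonneg)
        with bound[of \<omega> "Suc m"] show ?thesis by linarith
      qed
      thus "AE \<omega> in M. norm (f m \<omega>) \<le> norm (exp (s * \<bar>Y \<omega>\<bar>))"
        by simp
    qed measurable
    have "summable (\<lambda>m. \<integral>\<omega>. norm (f m \<omega>) \<partial>M)"
    proof (rule summableI_nonneg_bounded)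
      fix N
      have "(\<Sum>m<N. \<integral>\<omega>. norm (f m \<omega>) \<partial>M) = (\<integral>\<omega>. (\<Sum>m<N. norm (f m \<omega>)) \<partial>M)"
        using fint by (subst Bochner_Integration.integral_sum) auto
      also have "\<dots> \<le> (\<integral>\<omega>. exp (s * \<bar>Y \<omega>\<bar>) \<partial>M)"
        using fint expint bound by (intro integral_mono) auto
      finally show "(\<Sum>m<N. \<integral>\<omega>. norm (f m \<omega>) \<partial>M) \<le> (\<integral>\<omega>. exp (s * \<bar>Y \<omega>\<bar>) \<partial>M)" .
    qed auto
    moreover have "AE \<omega> in M. summable (\<lambda>m. norm (f m \<omega>))"
      using bound by (intro AE_I2 summableI_nonneg_bounded) auto
    ultimately have "(\<lambda>m. integral\<^sup>L M (f m)) sums (\<integral>\<omega>. (\<Sum>m. f m \<omega>) \<partial>M)"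
      using fint by (intro sums_integral) auto
    moreover have "(\<Sum>m. f m \<omega>) = degenerate_exp lam (- Y \<omega>) (- t)" for \<omega>
      using degenerate_exp_sums[of lam t "Y \<omega>"] lam elim by (simp add: sums_iff f_def)
    moreover have "integral\<^sup>L M (f m) = (\<integral>\<omega>. degenerate_rising lam m (Y \<omega>) \<partial>M) * t ^ m / fact m" for m
      by (simp add: f_def)
    ultimately show ?case
      by simp
  qed
qed

lemma exp_has_egf:
  fixes c :: "nat \<Rightarrow> real"
  assumes "\<forall>\<^sub>F t in nhds 0. (\<lambda>m. c m * t ^ m) sums f t"
  shows "\<exists>h. \<forall>\<^sub>F t in nhds 0. (\<lambda>m. h m * t ^ m / fact m) sums exp (x * (f t - 1))"
proof -
  define F where "F = Abs_fps (\<lambda>m. complex_of_real (c m))"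
  define Q where "Q = (\<lambda>z. exp (of_real x * (eval_fps F z - 1)))"
  have rad: "fps_conv_radius F = fps_conv_radius (Abs_fps c)"
    unfolding F_def fps_conv_radius_def conv_radius_def by simp
  from assms have "f has_fps_expansion Abs_fps c"
    by (intro has_fps_expansionI) auto
  hence "fps_conv_radius F > 0"
    by (simp add: rad has_fps_expansion_def)
  hence "eval_fps F analytic_on {0}"
    by (rule has_fps_expansion_imp_analytic_0[OF eval_fps_has_fps_expansion])
  hence "Q analytic_on {0}"
    unfolding Q_def using \<open>fps_conv_radius F > 0\<close>
    by (intro analytic_intros) (auto simp: zero_ereal_def)
  then obtain H where H: "Q has_fps_expansion H"
    using analytic_at_imp_has_fps_expansion_0 by blast
  define h where "h = (\<lambda>m. fact m * Re (fps_nth H m))"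
  have "\<forall>\<^sub>F z in nhds 0. ereal (norm z) < fps_conv_radius H \<and> eval_fps H z = Q z"
  proof (intro eventually_conj)
    show "\<forall>\<^sub>F z in nhds 0. eval_fps H z = Q z"
      using H by (simp add: has_fps_expansion_def)
    have "\<forall>\<^sub>F z in nhds 0. z \<in> eball 0 (fps_conv_radius H)"
      using H by (intro eventually_nhds_in_open) (auto simp: has_fps_expansion_def zero_ereal_def)
    thus "\<forall>\<^sub>F z in nhds 0. ereal (norm z) < fps_conv_radius H"
      by eventually_elim auto
  qed
  moreover have "filterlim complex_of_real (nhds 0) (nhds 0)"
    using tendsto_of_real[OF filterlim_ident[of "nhds (0::real)"], where 'a = complex] by simp
  ultimately have "\<forall>\<^sub>F t in nhds 0. ereal (norm (complex_of_real t)) < fps_conv_radius H \<and>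
      eval_fps H (of_real t) = Q (of_real t)"
    by (rule eventually_compose_filterlim)
  with assms have "\<forall>\<^sub>F t in nhds 0. (\<lambda>m. h m * t ^ m / fact m) sums exp (x * (f t - 1))"
  proof eventually_elim
    case (elim t)
    have "(\<lambda>m. complex_of_real (c m * t ^ m)) sums of_real (f t)"
      using elim(1) by (simp only: sums_of_real_iff)
    hence "eval_fps F (of_real t) = of_real (f t)"
      by (simp add: eval_fps_def F_def sums_iff)
    hence "Q (of_real t) = of_real (exp (x * (f t - 1)))"
      by (simp add: Q_def flip: exp_of_real)
    moreover have "(\<lambda>m. fps_nth H m * of_real t ^ m) sums eval_fps H (of_real t)"
      using elim(2) by (intro sums_eval_fps) auto
    ultimately have "(\<lambda>m. fps_nth H m * of_real (t ^ m)) sums of_real (exp (x * (f t - 1)))"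
      using elim(2) by simp
    from sums_Re[OF this] show ?case
      by (simp add: h_def)
  qed
  thus ?thesis by blast
qed

lemma prob_het_bell_sums:
  fixes M :: "'a measure" and Y :: "'a \<Rightarrow> real" and r lam x :: real
  assumes "Y \<in> borel_measurable M"
    and "\<And>m::nat. integrable M (\<lambda>\<omega>. \<bar>Y \<omega>\<bar> ^ m)"
    and "r > 0"
    and "\<And>t::real. \<bar>t\<bar> < r \<Longrightarrow>
           (\<lambda>m. \<bar>t\<bar> ^ m * (\<integral>\<omega>. \<bar>Y \<omega>\<bar> ^ m \<partial>M) / fact m) \<longlonglongrightarrow> 0"
    and "lam \<noteq> 0"
  shows "\<forall>\<^sub>F t in nhds 0.
    (\<lambda>m. prob_het_bell M Y lam m x * t ^ m / fact m) sums prob_het_bell_gf M Y lam x t"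
proof -
  let ?P = "\<lambda>h. \<forall>\<^sub>F t in nhds 0. (\<lambda>m. h m * t ^ m / fact m) sums prob_het_bell_gf M Y lam x t"
  have "\<exists>h. ?P h"
    unfolding prob_het_bell_gf_def
    by (rule exp_has_egf[where c = "\<lambda>m. (\<integral>\<omega>. degenerate_rising lam m (Y \<omega>) \<partial>M) / fact m"])
       (use expectation_degenerate_exp_sums[OF assms] in simp)
  hence "\<exists>!h. ?P h"
    using egf_unique by blast
  from theI'[OF this] show ?thesis
    by (simp add: prob_het_bell_def)
qed

lemma partial_bell_cong:
  assumes "k \<le> n" "\<And>m. 1 \<le> m \<Longrightarrow> m \<le> n - k + 1 \<Longrightarrow> xs m = ys m"
  shows "partial_bell n k xs = partial_bell n k ys"
proof -
  define F where "F = (\<lambda>xs. Abs_fps (\<lambda>m. if m = 0 then 0 else xs m / fact m :: real))"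
  define G where "G = (\<lambda>xs. Abs_fps (\<lambda>m. xs (Suc m) / fact (Suc m) :: real))"
  have FG: "F xs = fps_X * G xs" for xs
  proof (rule fps_ext)
    show "fps_nth (F xs) m = fps_nth (fps_X * G xs) m" for m
      by (cases m) (simp_all add: F_def G_def del: fact_Suc)
  qed
  have pw: "\<forall>j\<le>n-k. fps_nth (G xs ^ i) j = fps_nth (G ys ^ i) j" for i
  proof (induction i)
    case (Suc i)
    have "fps_nth (G xs) j = fps_nth (G ys) j" if "j \<le> n - k" for j
      using assms(2)[of "Suc j"] that by (simp add: G_def)
    with Suc show ?case
      by (auto simp: fps_mult_nth intro!: sum.cong)
  qed auto
  have "fps_nth (F xs ^ k) n = fps_nth (F ys ^ k) n"
    using pw[of k] assms(1) by (simp add: FG power_mult_distrib fps_X_power_mult_nth)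
  thus ?thesis
    by (simp add: partial_bell_def F_def)
qed

end

theory Submission
  imports Defs
begin

text \<open>
  Since \<open>Y\<close> lives on a probability space, the generating function \<open>g\<close> of the numbers \<open>H\<^sub>n\<close>
  satisfies \<open>g(0) = 1\<close>, and the one of the polynomials \<open>H\<^sub>n(x)\<close> is \<open>g powr x\<close>. Hence the latter is
  the binomial series \<open>(1 + z) powr x\<close> evaluated at \<open>z = g - 1\<close>, and expanding the powers of
  \<open>g - 1\<close> produces the partial Bell polynomials. That the substitution is valid follows
  without estimates, because both sides solve the formal differential equation \<open>G F' = x G' F\<close>,
  \<open>F(0) = 1\<close>.
\<close>

text \<open>Multiplying each equation by the other solution and cancelling \<open>G\<close> in the
  integral domain of power series gives \<open>A' B = A B'\<close>. So \<open>A / B\<close> has zero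
  derivative, and the constant terms force it to be 1.\<close>

lemma fps_log_deriv_unique:
  fixes A B G :: "'a :: field_char_0 fps"
  assumes "G \<noteq> 0"
    and A: "G * fps_deriv A = C * A" and B: "G * fps_deriv B = C * B"
    and "fps_nth A 0 = 1" "fps_nth B 0 = 1"
  shows "A = B"
proof -
  have inv: "B * inverse B = 1"
    using assms(5) by (simp add: inverse_mult_eq_1')
  have "G * (fps_deriv A * B) = (G * fps_deriv A) * B"
    by (simp add: mult_ac)
  also have "\<dots> = A * (G * fps_deriv B)"
    by (simp add: A B mult_ac)
  also have "\<dots> = G * (A * fps_deriv B)"
    by (simp add: mult_ac)
  finally have AB: "fps_deriv A * B = A * fps_deriv B"
    using \<open>G \<noteq> 0\<close> by simp
  \<comment> \<open>The first term carries an inserted \<open>B * inverse B = 1\<close>, so that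
    both terms share the factor \<open>(inverse B)\<^sup>2\<close>.\<close>
  have "fps_deriv (A * inverse B) =
      fps_deriv A * (B * inverse B) * inverse B - A * fps_deriv B * (inverse B)\<^sup>2"
    using assms(5) by (simp only: inv) (simp add: fps_inverse_deriv algebra_simps)
  also have "\<dots> = (fps_deriv A * B - A * fps_deriv B) * (inverse B)\<^sup>2"
    by (simp add: algebra_simps power2_eq_square)
  also have "\<dots> = 0"
    by (simp add: AB)
  finally have "A * inverse B = fps_const (fps_nth (A * inverse B) 0)"
    by (simp only: fps_deriv_eq_0_iff)
  hence "A * inverse B = 1"
    using assms(4,5) by simp
  hence "A * (B * inverse B) = B"
    by (metis mult.left_commute mult.right_neutral)
  thus ?thesis
    by (simp add: inv)
qed

text \<open>The binomial series \<open>b\<close> satisfies \<open>(1 + X) b' = c b\<close>.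
  Substituting \<open>G - 1\<close>, which has no constant term, for \<open>X\<close> turns
  \<open>1 + X\<close> into \<open>G\<close>, and the chain rule supplies the factor
  \<open>G'\<close>.\<close>

lemma fps_deriv_binomial_compose:
  fixes G :: "'a :: field_char_0 fps"
  assumes "fps_nth G 0 = 1"
  shows "G * fps_deriv (fps_binomial c oo (G - 1)) =
           fps_const c * fps_deriv G * (fps_binomial c oo (G - 1))"
proof -
  let ?X = "1 + fps_X :: 'a fps"
  have "?X * fps_deriv (fps_binomial c) = fps_const c * fps_binomial c * (?X * inverse ?X)"
    by (simp add: fps_binomial_deriv fps_divide_unit mult_ac)
  also have "?X * inverse ?X = 1"
    by (rule inverse_mult_eq_1') simp
  finally have "(1 + fps_X) * fps_deriv (fps_binomial c) = fps_const c * fps_binomial c"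
    by simp
  hence "((1 + fps_X) * fps_deriv (fps_binomial c)) oo (G - 1) =
      (fps_const c * fps_binomial c) oo (G - 1)"
    by simp
  moreover have "(1 + fps_X) oo (G - 1) = G"
    using assms by (simp add: fps_compose_add_distrib)
  ultimately have "G * (fps_deriv (fps_binomial c) oo (G - 1)) =
      fps_const c * (fps_binomial c oo (G - 1))"
    using assms by (simp add: fps_compose_mult_distrib)
  thus ?thesis
    using assms by (simp add: fps_compose_deriv mult.commute mult.left_commute)
qed

lemma has_fps_expansion_imp_sums_real:
  fixes f :: "real \<Rightarrow> real"
  assumes "f has_fps_expansion F"
  shows "\<forall>\<^sub>F t in nhds 0. (\<lambda>n. fps_nth F n * t ^ n) sums f t"
proof -
  have "\<forall>\<^sub>F t in nhds 0. t \<in> eball 0 (fps_conv_radius F)"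
    using assms by (intro eventually_nhds_in_open) (auto simp: has_fps_expansion_def zero_ereal_def)
  moreover have "\<forall>\<^sub>F t in nhds 0. eval_fps F t = f t"
    using assms by (simp add: has_fps_expansion_def)
  ultimately show ?thesis
  proof eventually_elim
    case (elim t)
    thus ?case using sums_eval_fps[of t F] by auto
  qed
qed

lemma fps_expansion_unique_real:
  fixes f :: "real \<Rightarrow> real"
  assumes "f has_fps_expansion F" "f has_fps_expansion G"
  shows "F = G"
proof -
  \<comment> \<open>The factorials cancel the denominators in \<open>egf_unique\<close>.\<close>
  have "(\<lambda>n. fact n * fps_nth F n) = (\<lambda>n. fact n * fps_nth G n)"
    by (rule egf_unique[where f = f])
       (use assms[THEN has_fps_expansion_imp_sums_real] in simp_all)
  thus ?thesis
    by (simp add: fun_eq_iff fps_eq_iff)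
qed

lemma has_fps_expansion_imp_eventually_DERIV:
  fixes f :: "real \<Rightarrow> real"
  assumes "f has_fps_expansion F"
  shows "\<forall>\<^sub>F t in nhds 0. (f has_field_derivative deriv f t) (at t)"
proof -
  have "\<forall>\<^sub>F t in nhds 0. t \<in> eball 0 (fps_conv_radius F)"
    using assms by (intro eventually_nhds_in_open) (auto simp: has_fps_expansion_def zero_ereal_def)
  \<comment> \<open>A derivative at \<open>t\<close> transfers from the series to \<open>f\<close>
    only if they agree on a whole neighbourhood of \<open>t\<close>, hence the nested
    quantifier.\<close>
  moreover have "\<forall>\<^sub>F t in nhds 0. \<forall>\<^sub>F s in nhds t. eval_fps F s = f s"
    using assms by (simp add: has_fps_expansion_def eventually_eventually)
  ultimately show ?thesis
  proof eventually_elim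
    case (elim t)
    have "(eval_fps F has_field_derivative eval_fps (fps_deriv F) t) (at t)"
      using elim by (intro has_field_derivative_eval_fps) auto
    hence "(f has_field_derivative eval_fps (fps_deriv F) t) (at t)"
      using elim DERIV_cong_ev[of t t "eval_fps F" f] by blast
    thus ?case
      using DERIV_imp_deriv by force
  qed
qed

text \<open>Differentiating \<open>h = g powr x\<close> near 0 gives \<open>g h' = x g' h\<close>.
  Expanding both sides turns this into the formal equation for \<open>H\<close>, whose normalized
  solution is unique.\<close>

lemma fps_expansion_powr_real:
  fixes g :: "real \<Rightarrow> real"
  assumes g: "g has_fps_expansion G" and h: "(\<lambda>t. g t powr x) has_fps_expansion H"
    and G0: "fps_nth G 0 = 1"
  shows "H = fps_binomial x oo (G - 1)"
proof -
  define h where "h = (\<lambda>t. g t powr x)"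
  have h': "h has_fps_expansion H"
    using h by (simp add: h_def)
  have g0: "g 0 = 1"
    using has_fps_expansion_imp_0_eq_fps_nth_0[OF g] G0 by simp
  have "(g \<longlongrightarrow> 1) (nhds 0)"
    using has_fps_expansion_imp_continuous[OF g, of UNIV] g0
    by (simp add: isCont_def tendsto_nhds_iff)
  \<comment> \<open>Positivity of the base is what the derivative rule for \<open>powr\<close>
    needs.\<close>
  hence "\<forall>\<^sub>F t in nhds 0. g t > 0"
    by (rule order_tendstoD(1)) simp
  with has_fps_expansion_imp_eventually_DERIV[OF g]
  have ode: "\<forall>\<^sub>F t in nhds 0. g t * deriv h t = x * deriv g t * h t"
  proof eventually_elim
    case (elim t)
    have "(h has_field_derivative x * g t powr (x - 1) * deriv g t) (at t)"
      unfolding h_def using elim by (auto intro!: derivative_eq_intros simp: powr_diff field_simps)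
    hence "deriv h t = x * g t powr (x - 1) * deriv g t"
      by (rule DERIV_imp_deriv)
    thus ?case
      using elim by (simp add: h_def powr_diff field_simps)
  qed
  have "(\<lambda>t. g t * deriv h t) has_fps_expansion G * fps_deriv H"
    by (intro fps_expansion_intros g h')
  hence "(\<lambda>t. x * deriv g t * h t) has_fps_expansion G * fps_deriv H"
    using has_fps_expansion_cong[OF ode refl] by blast
  moreover have "(\<lambda>t. x * deriv g t * h t) has_fps_expansion fps_const x * fps_deriv G * H"
    by (intro fps_expansion_intros g h')
  ultimately have "G * fps_deriv H = fps_const x * fps_deriv G * H"
    by (rule fps_expansion_unique_real)
  moreover have "fps_nth H 0 = 1"
    using has_fps_expansion_imp_0_eq_fps_nth_0[OF h] g0 by simp
  moreover have "G \<noteq> 0"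
    using G0 by auto
  ultimately show ?thesis
    by (intro fps_log_deriv_unique[OF _ _ fps_deriv_binomial_compose[OF G0]]) simp_all
qed

theorem theorem2p11:
  fixes M :: "'a measure" and Y :: "'a \<Rightarrow> real" and r lam x :: real and n :: nat
  assumes "prob_space M"
    and "Y \<in> borel_measurable M"
    and "\<And>m::nat. integrable M (\<lambda>\<omega>. \<bar>Y \<omega>\<bar> ^ m)"
    and "r > 0"
    and "\<And>t::real. \<bar>t\<bar> < r \<Longrightarrow>
           (\<lambda>m. \<bar>t\<bar> ^ m * (\<integral>\<omega>. \<bar>Y \<omega>\<bar> ^ m \<partial>M) / fact m) \<longlonglongrightarrow> 0"
    and "lam \<noteq> 0"
  shows "prob_het_bell M Y lam n x =
    (\<Sum>k=0..n. (x gchoose k) * fact k * partial_bell n k (\<lambda>m. prob_het_bell M Y lam m 1))"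
proof -
  interpret prob_space M by fact
  define S where "S = (\<lambda>x. Abs_fps (\<lambda>m. prob_het_bell M Y lam m x / fact m))"
  have S: "prob_het_bell_gf M Y lam x has_fps_expansion S x" for x
    using prob_het_bell_sums[OF assms(2-6), of x]
    by (intro has_fps_expansionI) (simp add: S_def)
  \<comment> \<open>At \<open>t = 0\<close> the integrand is constantly 1, so its integral is the
    total mass 1 and the exponent vanishes.\<close>
  have "prob_het_bell_gf M Y lam 1 0 = 1"
    by (simp add: prob_het_bell_gf_def degenerate_exp_def prob_space)
  hence S0: "fps_nth (S 1) 0 = 1"
    using has_fps_expansion_imp_0_eq_fps_nth_0[OF S[of 1]] by simp
  have "prob_het_bell_gf M Y lam x = (\<lambda>t. prob_het_bell_gf M Y lam 1 t powr x)"
    by (simp add: prob_het_bell_gf_def powr_def fun_eq_iff)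
  hence "S x = fps_binomial x oo (S 1 - 1)"
    using S[of x] by (intro fps_expansion_powr_real[OF S _ S0]) simp
  hence "prob_het_bell M Y lam n x / fact n = (\<Sum>k=0..n. (x gchoose k) * fps_nth ((S 1 - 1) ^ k) n)"
    by (simp add: S_def fps_eq_iff fps_compose_nth)
  \<comment> \<open>Subtracting 1 removes exactly the constant term, which leaves the series whose
    powers define \<open>partial_bell\<close>; the \<open>1 / fact k\<close> there cancels the
    \<open>fact k\<close> of the claim.\<close>
  moreover have "S 1 - 1 = Abs_fps (\<lambda>m. if m = 0 then 0 else prob_het_bell M Y lam m 1 / fact m)"
    using S0 by (auto simp: S_def fps_eq_iff)
  ultimately show ?thesis
    by (simp add: partial_bell_def field_simps sum_distrib_left)
qed

end
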